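(* For every integer $n\ge 3$ there exists a goods instance with $n$ agents and normalized bivalued additive valuations that admits no allocation that is both EF1 and EQ1.
   Context: An instance consists of agents $N=\{1,\dots,n\}$, a finite set $M$ of indivisible items, and for each agent $i$ an additive valuation $v_i:2^M\to\mathbb{R}$, i.e. $v_i(\emptyset)=0$ and $v_i(S)=\sum_{o\in S}v_i(o)$. It is a goods instance if $v_i(o)\ge0$ for all $i,o$. It is normalized if $v_i(M)=v_j(M)$ for all $i,j\in N$. It is bivalued if for every agent $i$ there exist $p_i,q_i\in\mathbb{R}$ (possibly depending on $i$) with $v_i(o)\in\{p_i,q_i\}$ for every $o\in M$. An allocation $A=(A_1,\dots,A_n)$ is a partition of $M$ into $n$ pairwise disjoint, possibly empty bundles with union $M$. For goods: $A$ is EF1 if for all $i,j\in N$ with $A_j\neq\emptyset$ there is $g\in A_j$ with $v_i(A_i)\ge v_i(A_j\setminus\{g\})$. $A$ is EQ1 if for all $i,j\in N$ with $A_j\neq\emptyset$ there is $g\in A_j$ with $v_i(A_i)\ge v_j(A_j\setminus\{g\})$. *)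

theory Defs
  imports Complex_Main "HOL-Library.Disjoint_Sets"
begin

text \<open>
  A valuation is a total function on \<^typ>\<open>'a set\<close>; only its values on subsets of the
  item set \<open>M\<close> are meaningful. Agents are the natural numbers \<open>1, \<dots>, n\<close>.
\<close>

definition additive_on :: "'a set \<Rightarrow> ('a set \<Rightarrow> real) \<Rightarrow> bool" where
  "additive_on M u \<longleftrightarrow> u {} = 0 \<and> (\<forall>S\<subseteq>M. u S = (\<Sum>x\<in>S. u {x}))"

definition fair_instance :: "nat \<Rightarrow> 'a set \<Rightarrow> (nat \<Rightarrow> 'a set \<Rightarrow> real) \<Rightarrow> bool" where
  "fair_instance n M v \<longleftrightarrow> finite M \<and> (\<forall>i\<in>{1..n}. additive_on M (v i))"

definition goods_instance :: "nat \<Rightarrow> 'a set \<Rightarrow> (nat \<Rightarrow> 'a set \<Rightarrow> real) \<Rightarrow> bool" where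
  "goods_instance n M v \<longleftrightarrow> fair_instance n M v \<and> (\<forall>i\<in>{1..n}. \<forall>x\<in>M. 0 \<le> v i {x})"

definition normalized :: "nat \<Rightarrow> 'a set \<Rightarrow> (nat \<Rightarrow> 'a set \<Rightarrow> real) \<Rightarrow> bool" where
  "normalized n M v \<longleftrightarrow> (\<forall>i\<in>{1..n}. \<forall>j\<in>{1..n}. v i M = v j M)"

definition bivalued :: "nat \<Rightarrow> 'a set \<Rightarrow> (nat \<Rightarrow> 'a set \<Rightarrow> real) \<Rightarrow> bool" where
  "bivalued n M v \<longleftrightarrow> (\<forall>i\<in>{1..n}. \<exists>p q. \<forall>x\<in>M. v i {x} \<in> {p, q})"

definition allocation :: "nat \<Rightarrow> 'a set \<Rightarrow> (nat \<Rightarrow> 'a set) \<Rightarrow> bool" where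
  "allocation n M A \<longleftrightarrow> disjoint_family_on A {1..n} \<and> (\<Union>i\<in>{1..n}. A i) = M"

text \<open>The two fairness notions below are the versions for goods.\<close>

definition EF1 :: "nat \<Rightarrow> (nat \<Rightarrow> 'a set \<Rightarrow> real) \<Rightarrow> (nat \<Rightarrow> 'a set) \<Rightarrow> bool" where
  "EF1 n v A \<longleftrightarrow>
    (\<forall>i\<in>{1..n}. \<forall>j\<in>{1..n}. A j \<noteq> {} \<longrightarrow> (\<exists>g\<in>A j. v i (A i) \<ge> v i (A j - {g})))"

definition EQ1 :: "nat \<Rightarrow> (nat \<Rightarrow> 'a set \<Rightarrow> real) \<Rightarrow> (nat \<Rightarrow> 'a set) \<Rightarrow> bool" where
  "EQ1 n v A \<longleftrightarrow>
    (\<forall>i\<in>{1..n}. \<forall>j\<in>{1..n}. A j \<noteq> {} \<longrightarrow> (\<exists>g\<in>A j. v i (A i) \<ge> v j (A j - {g})))"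

end

theory Submission
  imports Defs
begin

text \<open>
  Agents \<open>1, \<dots>, n - 1\<close> value only \<open>n - 2\<close> special items, all equally, while agent \<open>n\<close> values all
  \<open>2 n + 1\<close> items equally. In any allocation some agent below \<open>n\<close> gets no special item and hence
  value \<open>0\<close>. By EQ1 agent \<open>n\<close> then has at most one item, so by EF1 nobody has more than two items,
  and some item remains unallocated.
\<close>

lemma additive_on_sum: "additive_on M (\<lambda>S. \<Sum>x\<in>S. w x)"
  by (simp add: additive_on_def)

text \<open>Pigeonhole: if every \<open>A i\<close> met \<open>S\<close>, choosing a point of each
  \<open>A i \<inter> S\<close> would, by disjointness, give an injection of \<open>I\<close> into
  \<open>S\<close>.\<close>

lemma exists_disjoint_family_avoiding:
  assumes "disjoint_family_on A I" "finite S" "card S < card I"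
  shows "\<exists>i\<in>I. A i \<inter> S = {}"
proof (rule ccontr)
  assume "\<not> ?thesis"
  then have "\<forall>i\<in>I. \<exists>x. x \<in> A i \<inter> S"
    by blast
  then obtain f where f: "f i \<in> A i \<inter> S" if "i \<in> I" for i
    by metis
  have "inj_on f I"
  proof (rule inj_onI)
    fix i j assume "i \<in> I" "j \<in> I" "f i = f j"
    then have "f i \<in> A i \<inter> A j"
      using f by (metis IntD1 IntI)
    with assms(1) \<open>i \<in> I\<close> \<open>j \<in> I\<close> show "i = j"
      by (auto simp: disjoint_family_on_def)
  qed
  moreover have "f ` I \<subseteq> S"
    using f by auto
  ultimately have "card I \<le> card S"
    using \<open>finite S\<close> card_inj_on_le by blast
  with assms(3) show False
    by simp
qed

theorem proposition1:
  fixes n :: nat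
  assumes "n \<ge> 3"
  shows "\<exists>(M :: nat set) (v :: nat \<Rightarrow> nat set \<Rightarrow> real).
           goods_instance n M v \<and> normalized n M v \<and> bivalued n M v \<and>
           \<not> (\<exists>A. allocation n M A \<and> EF1 n v A \<and> EQ1 n v A)"
proof -
  define M where "M = {..<2 * n + 1}"
  define S where "S = {..<n - 2}"
  \<comment> \<open>The two nonzero values are chosen so that every agent assigns \<open>M\<close> the value \<open>(n - 2) (2 n + 1)\<close>.\<close>
  define w :: "nat \<Rightarrow> nat \<Rightarrow> real"
    where "w i x = (if i = n then real (n - 2) else if x \<in> S then real (2 * n + 1) else 0)" for i x
  define v where "v i T = (\<Sum>x\<in>T. w i x)" for i T
  have finM: "finite M"
    by (simp add: M_def)
  have "M \<inter> S = S"
    by (auto simp: M_def S_def)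
  have "additive_on M (v i)" for i
    unfolding v_def by (rule additive_on_sum)
  then have goods: "goods_instance n M v"
    by (simp add: goods_instance_def fair_instance_def v_def w_def finM)
  have "v i M = real (n - 2) * real (2 * n + 1)" for i
  proof (cases "i = n")
    case True
    then show ?thesis
      by (simp add: v_def w_def M_def)
  next
    case False
    then have "v i M = (\<Sum>x\<in>M \<inter> S. real (2 * n + 1))"
      using sum.inter_restrict[of M "\<lambda>_. real (2 * n + 1)" S]
      by (simp add: v_def w_def finM)
    with \<open>M \<inter> S = S\<close> show ?thesis
      by (simp add: S_def)
  qed
  then have normalized: "normalized n M v"
    by (simp add: normalized_def)
  have "\<exists>p q. \<forall>x\<in>M. v i {x} \<in> {p, q}" for i
    by (cases "i = n") (auto simp: v_def w_def)
  then have bivalued: "bivalued n M v"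
    by (simp add: bivalued_def)
  have "\<not> (allocation n M A \<and> EF1 n v A \<and> EQ1 n v A)" for A
  proof
    assume A: "allocation n M A \<and> EF1 n v A \<and> EQ1 n v A"
    then have EF1: "EF1 n v A" and EQ1: "EQ1 n v A" and disj: "disjoint_family_on A {1..n}" and M: "(\<Union>i\<in>{1..n}. A i) = M"
      by (auto simp: allocation_def)
    have fin: "finite (A j)" if "j \<in> {1..n}" for j
      using M that finM by (metis UN_upper finite_subset)
    have vn: "v n T = real (n - 2) * real (card T)" for T
      by (simp add: v_def w_def)
    \<comment> \<open>With this factor positive, inequalities between values for agent
      \<open>n\<close> turn into inequalities between cardinalities.\<close>
    have pos: "real (n - 2) > 0"
      using assms by simp
    \<comment> \<open>Agent \<open>n\<close> is left out: the other \<open>n - 1\<close> agents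
      still outnumber the \<open>n - 2\<close> special items, and they value nothing else.\<close>
    have "disjoint_family_on A {1..<n}"
      using disj by (rule disjoint_family_on_mono[rotated]) auto
    moreover have "finite S" "card S < card {1..<n}"
      using assms by (auto simp: S_def)
    ultimately obtain i where i: "i \<in> {1..<n}" "A i \<inter> S = {}"
      using exists_disjoint_family_avoiding by blast
    then have i': "i \<in> {1..n}" and n: "n \<in> {1..n}"
      by auto
    from i have "v i (A i) = 0"
      unfolding v_def w_def by (intro sum.neutral) auto
    have "card (A n) \<le> 1"
    proof (cases "A n = {}")
      case False
      \<comment> \<open>EQ1 compares the value 0 that \<open>i\<close> has with what agent
        \<open>n\<close> keeps after losing \<open>g\<close>, so nothing may remain.\<close>
      then obtain g where "g \<in> A n" "v i (A i) \<ge> v n (A n - {g})"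
        using EQ1 i' n unfolding EQ1_def by blast
      with \<open>v i (A i) = 0\<close> pos have "card (A n - {g}) = 0"
        by (simp add: vn mult_le_0_iff del: card_Diff_insert)
      with \<open>g \<in> A n\<close> show ?thesis
        using fin[of n] assms by simp
    qed simp
    have "card (A j) \<le> 2" if j: "j \<in> {1..n}" for j
    proof (cases "A j = {}")
      case False
      \<comment> \<open>Here agent \<open>n\<close> is the envious one, and its valuation counts
        items: \<open>A j\<close> has at most one item more than \<open>A n\<close>.\<close>
      then obtain g where g: "g \<in> A j" "v n (A n) \<ge> v n (A j - {g})"
        using EF1 j n unfolding EF1_def by blast
      with pos have "card (A j - {g}) \<le> card (A n)"
        by (simp add: vn)
      with \<open>card (A n) \<le> 1\<close> g fin[OF j] show ?thesis
        by simp
    qed simp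
    \<comment> \<open>The bundles cover at most \<open>2 * n\<close> items, one fewer than
      \<open>M\<close> contains.\<close>
    then have "(\<Sum>j\<in>{1..n}. card (A j)) \<le> (\<Sum>j\<in>{1..n}. 2)"
      by (intro sum_mono)
    moreover have "card M \<le> (\<Sum>j\<in>{1..n}. card (A j))"
      unfolding M[symmetric] by (rule card_UN_le) simp
    ultimately show False
      by (simp add: M_def)
  qed
  with goods normalized bivalued show ?thesis
    by blast
qed

end
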